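(* Let $\Xi=\{\xi\in\mathbb{R}^m : C\xi\le h\}$ be compact, where $C\in\mathbb{R}^{q\times m}$ and $h\in\mathbb{R}^q$ for some integer $q>0$. Let $X\subseteq\mathbb{R}^n$ be closed and convex, $c\in\mathbb{R}^n$, $\alpha\in(0,1)$, $\theta>0$, and $\widehat\xi_1,\dots,\widehat\xi_N\in\Xi$. Suppose that for some positive integer $K$, $F(x,\xi):=\max_{k\le K}\bigl(x^\top A_k\xi+b_k(x)\bigr)$, where $A_k\in\mathbb{R}^{n\times m}$ and $b_k:\mathbb{R}^n\to\mathbb{R}$ is convex for all $k\in\{1,\dots,K\}$. Let $\|\cdot\|$ be the Euclidean norm. Then the problem in the variables $(x,\lambda,t,\{s_i\}_{i=1}^N)$ $$\begin{aligned}\min\ & c^\top x\\ \text{s.t. } & \lambda\theta+\tfrac1N\textstyle\sum_{i=1}^N s_i\le t\alpha,\\ & s_i\ge\sup_{\xi\in\Xi}\bigl[F(x,\xi)+t-\lambda\|\xi-\widehat\xi_i\|\bigr],\quad \forall i\in\{1,\dots,N\},\\ & \lambda\ge0,\ t\in\mathbb{R},\ x\in X,\ s_i\ge0,\quad\forall i\in\{1,\dots,N\}\end{aligned}$$ is equivalent to the following convex optimization problem in the variables $(x,\lambda,t,\{s_i\}_{i=1}^N,\{\eta_{ik}\})$ with $\eta_{ik}\in\mathbb{R}^q$: $$\begin{aligned}\min\ & c^\top x\\ \text{s.t. } & \lambda\theta+\tfrac1N\textstyle\sum_{i=1}^N s_i\le t\alpha,\\ & \bigl(b_k(x)+t+(A_k^\top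 x-C^\top\eta_{ik})^\top\widehat\xi_i+\eta_{ik}^\top h\bigr)_+\le s_i,\quad\forall i\in\{1,\dots,N\},\,k\in\{1,\dots,K\},\\ & \|A_k^\top x-C^\top\eta_{ik}\|\le\lambda,\quad \eta_{ik}\ge0,\quad\forall i\in\{1,\dots,N\},\,k\in\{1,\dots,K\},\\ & x\in X,\ t\in\mathbb{R},\ \lambda\ge0,\end{aligned}$$ in the sense that $(x,\lambda,t,\{s_i\})$ is feasible for the first problem if and only if there exist $\{\eta_{ik}\}$ such that $(x,\lambda,t,\{s_i\},\{\eta_{ik}\})$ is feasible for the second (the objectives being identical).
   Context: $z_+:=\max(z,0)$; vector inequalities are componentwise. The first problem is the reformulation of the conditional-value-at-risk approximation of the chance constrained program that is distributionally robust over the $1$-Wasserstein ball of radius $\theta$ (with Euclidean ground metric $d(\xi,\omega)=\|\xi-\omega\|$) centered at the empirical distribution $\frac1N\sum_{i=1}^N\delta_{\widehat\xi_i}$. *)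

theory Defs
  imports "HOL-Analysis.Analysis"
begin

text \<open>
  The index types \<open>'n\<close>, \<open>'m\<close>, \<open>'q\<close> stand for the dimensions, \<open>'i\<close> for the \<open>N\<close> samples and
  \<open>'k\<close> for the \<open>K\<close> pieces of \<open>F\<close>.  The order on \<open>real ^ 'q\<close> is the componentwise one.

  In \<open>cvar_feasible\<close> the supremum is formed in the extended reals, so that it is the least upper
  bound whatever \<open>F\<close> and \<open>\<Xi>\<close> are; the supremum on \<open>real\<close> is unspecified for empty or
  unbounded sets.
\<close>

definition cvar_feasible ::
    "(real ^ 'n \<Rightarrow> real ^ 'm \<Rightarrow> real) \<Rightarrow> (real ^ 'm) set \<Rightarrow> (real ^ 'n) set
      \<Rightarrow> ('i::finite \<Rightarrow> real ^ 'm) \<Rightarrow> real \<Rightarrow> real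
      \<Rightarrow> ((real ^ 'n) \<times> real \<times> real \<times> (real ^ 'i)) set" where
  "cvar_feasible F \<Xi> X xihat \<theta> \<alpha> =
    {(x, lam, t, s).
        lam * \<theta> + 1 / real CARD('i) * (\<Sum>i\<in>UNIV. s $ i) \<le> t * \<alpha>
      \<and> (\<forall>i. ereal (s $ i) \<ge> (SUP \<xi>\<in>\<Xi>. ereal (F x \<xi> + t - lam * norm (\<xi> - xihat i))))
      \<and> lam \<ge> 0 \<and> x \<in> X \<and> (\<forall>i. s $ i \<ge> 0)}"

definition cvar_objective :: "real ^ 'n \<Rightarrow> (real ^ 'n) \<times> real \<times> real \<times> (real ^ 'i) \<Rightarrow> real" where
  "cvar_objective c = (\<lambda>(x, lam, t, s). c \<bullet> x)"

text \<open>The multiplier \<open>\<eta>\<^sub>i\<^sub>k\<close> is \<open>\<eta> $ i $ k\<close>.\<close>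

definition dual_feasible ::
    "real ^ 'm ^ 'q \<Rightarrow> real ^ 'q \<Rightarrow> ('k::finite \<Rightarrow> real ^ 'm ^ 'n) \<Rightarrow> ('k \<Rightarrow> real ^ 'n \<Rightarrow> real)
      \<Rightarrow> (real ^ 'n) set \<Rightarrow> ('i::finite \<Rightarrow> real ^ 'm) \<Rightarrow> real \<Rightarrow> real
      \<Rightarrow> ((real ^ 'n) \<times> real \<times> real \<times> (real ^ 'i) \<times> (real ^ 'q ^ 'k ^ 'i)) set" where
  "dual_feasible C h A b X xihat \<theta> \<alpha> =
    {(x, lam, t, s, \<eta>).
        lam * \<theta> + 1 / real CARD('i) * (\<Sum>i\<in>UNIV. s $ i) \<le> t * \<alpha>
      \<and> (\<forall>i k. max (b k x + t
                     + (transpose (A k) *v x - transpose C *v (\<eta> $ i $ k)) \<bullet> xihat i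
                     + (\<eta> $ i $ k) \<bullet> h) 0 \<le> s $ i)
      \<and> (\<forall>i k. norm (transpose (A k) *v x - transpose C *v (\<eta> $ i $ k)) \<le> lam
                 \<and> \<eta> $ i $ k \<ge> 0)
      \<and> x \<in> X \<and> lam \<ge> 0}"

definition dual_objective ::
    "real ^ 'n \<Rightarrow> (real ^ 'n) \<times> real \<times> real \<times> (real ^ 'i) \<times> (real ^ 'q ^ 'k ^ 'i) \<Rightarrow> real" where
  "dual_objective c = (\<lambda>(x, lam, t, s, \<eta>). c \<bullet> x)"

end

(*
  Write v = A_k^T x.  The set of all (C^T eta + w, eta . h + rho + w . xi_0) with eta, rho >= 0 and
  |w| <= lambda is the sum of a finitely generated cone and a compact set, hence closed and convex.
  A multiplier eta exists iff (v, r) lies in it.  Otherwise a separating hyperplane yields (xi, tau)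
  with tau >= 0, C xi <= tau h and v . xi - lambda |xi - tau xi_0| > tau r: for tau > 0 the point
  xi / tau of Xi violates the primal bound, for tau = 0 a point far out on the ray
  xi_0 + s xi does.  The converse is weak duality, via Cauchy-Schwarz.
*)
theory Submission
  imports Defs
begin

section \<open>Closedness of linear images of the nonnegative orthant\<close>

text \<open>Being generated by a finite set passes to linear images, which is what the closedness
  argument uses. The coordinate expansion of a point of the orthant is already a nonnegative
  combination of the generators.\<close>

lemma nonneg_orthant_eq_convex_cone_hull_Basis:
  "{x :: 'a::euclidean_space. \<forall>b\<in>Basis. 0 \<le> x \<bullet> b} = convex_cone hull Basis"
proof
  show "{x :: 'a. \<forall>b\<in>Basis. 0 \<le> x \<bullet> b} \<subseteq> convex_cone hull Basis"
  proof clarify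
    fix x :: 'a assume x: "\<forall>b\<in>Basis. 0 \<le> x \<bullet> b"
    have "(\<Sum>b\<in>B. (x \<bullet> b) *\<^sub>R b) \<in> convex_cone hull Basis" if "finite B" "B \<subseteq> Basis" for B
      using that
    proof (induction B rule: finite_induct)
      case empty
      then show ?case by (simp add: convex_cone_hull_contains_0)
    next
      case (insert b B)
      then have "(x \<bullet> b) *\<^sub>R b \<in> convex_cone hull Basis"
        using x by (intro convex_cone_hull_mul hull_inc) auto
      with insert show ?case by (simp add: convex_cone_hull_add)
    qed
    from this[of Basis] show "x \<in> convex_cone hull Basis"
      by (simp add: euclidean_representation)
  qed
  show "convex_cone hull Basis \<subseteq> {x :: 'a. \<forall>b\<in>Basis. 0 \<le> x \<bullet> b}"
    by (rule hull_minimal) (auto simp: convex_cone_iff inner_add_left inner_Basis)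
qed

text \<open>A linear image of a closed convex cone can fail to be closed. Here the image is
  generated by the finitely many images of the basis vectors, and finitely generated cones are
  closed.\<close>

lemma closed_linear_image_nonneg_orthant:
  fixes f :: "'a::euclidean_space \<Rightarrow> 'b::euclidean_space"
  assumes "linear f"
  shows "closed (f ` {x. \<forall>b\<in>Basis. 0 \<le> x \<bullet> b})"
  unfolding nonneg_orthant_eq_convex_cone_hull_Basis
  using closed_convex_cone_hull[of "f ` Basis"]
  by (simp add: convex_cone_hull_linear_image[OF assms])

lemma zero_le_vec_iff: "0 \<le> (x :: real ^ 'n) \<longleftrightarrow> (\<forall>i. 0 \<le> x $ i)"
  by (simp add: less_eq_vec_def)

lemma inner_transpose_mult: "(transpose M *v y) \<bullet> x = y \<bullet> ((M :: real ^ 'm ^ 'n) *v x)"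
  by (simp add: dot_lmul_matrix)

lemma inner_mono_nonneg_vec:
  fixes y z w :: "real ^ 'n"
  assumes "0 \<le> y" "z \<le> w"
  shows "y \<bullet> z \<le> y \<bullet> w"
  using assms by (auto simp: inner_vec_def less_eq_vec_def intro!: sum_mono mult_left_mono)

text \<open>With a negative slope \<open>x\<close> the value \<open>\<beta>\<close> would be
  attained at \<open>s = \<beta> / x\<close>, an admissible parameter since \<open>s = 0\<close>
  forces \<open>\<beta> < 0\<close>. This turns a separating inequality along a ray into a sign
  condition.\<close>

lemma nonneg_on_ray_if_bounded_below:
  fixes x :: real
  assumes "\<And>s. 0 \<le> s \<Longrightarrow> \<beta> < s * x"
  shows "0 \<le> x"
proof (rule ccontr)
  assume "\<not> 0 \<le> x"
  moreover from this have "\<beta> < 0" using assms[of 0] by simp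
  ultimately show False using assms[of "\<beta> / x"] by (simp add: divide_nonpos_neg)
qed

section \<open>Strong and weak duality for a single affine piece\<close>

text \<open>Strong duality with an attained multiplier; attainment comes from the closedness of
  \<open>S\<close>. For \<open>lam = 0\<close> this is the affine Farkas lemma.\<close>

lemma norm_penalised_Farkas:
  fixes C :: "real ^ 'm ^ 'q" and v \<xi>0 :: "real ^ 'm"
  assumes lam: "0 \<le> lam" and \<xi>0: "C *v \<xi>0 \<le> h"
    and bound: "\<And>\<xi>. C *v \<xi> \<le> h \<Longrightarrow> v \<bullet> \<xi> - lam * norm (\<xi> - \<xi>0) \<le> r"
  shows "\<exists>\<eta>\<ge>0. norm (v - transpose C *v \<eta>) \<le> lam
           \<and> (v - transpose C *v \<eta>) \<bullet> \<xi>0 + \<eta> \<bullet> h \<le> r"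
proof -
  \<comment> \<open>\<open>\<rho>\<close> is the slack of the final inequality
    \<open>\<le> r\<close>, so that the existence of \<open>\<eta>\<close> becomes membership of
    \<open>(v, r)\<close> in \<open>S\<close>.\<close>
  define f :: "(real ^ 'q) \<times> real \<Rightarrow> (real ^ 'm) \<times> real"
    where "f = (\<lambda>(\<eta>, \<rho>). (transpose C *v \<eta>, \<eta> \<bullet> h + \<rho>))"
  \<comment> \<open>\<open>w\<close> plays the residual \<open>v - transpose C *v \<eta>\<close>. It
    ranges over a Euclidean ball because the Euclidean norm is its own dual.\<close>
  define g :: "real ^ 'm \<Rightarrow> (real ^ 'm) \<times> real" where "g = (\<lambda>w. (w, w \<bullet> \<xi>0))"
  define P where "P = {p :: (real ^ 'q) \<times> real. \<forall>b\<in>Basis. 0 \<le> p \<bullet> b}"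
  define S where "S = (\<Union>p\<in>f ` P. \<Union>k\<in>g ` cball 0 lam. {p + k})"
  have P_iff: "(\<eta>, \<rho>) \<in> P \<longleftrightarrow> 0 \<le> \<eta> \<and> 0 \<le> \<rho>" for \<eta> \<rho>
    by (auto simp: P_def Basis_prod_def zero_le_vec_iff Basis_vec_def inner_axis)
  have lin_f: "linear f"
    by (rule linearI) (auto simp: f_def matrix_vector_right_distrib inner_add_left
        matrix_vector_mult_scaleR algebra_simps simp del: transpose_matrix_vector)
  have lin_g: "linear g"
    by (rule linearI) (auto simp: g_def inner_add_left)
  have "closed (f ` P)"
    unfolding P_def by (rule closed_linear_image_nonneg_orthant[OF lin_f])
  moreover have "compact (g ` cball 0 lam)"
    using lin_g by (intro compact_continuous_image linear_continuous_on)
      (auto simp: linear_conv_bounded_linear)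
  ultimately have "closed S"
    unfolding S_def by (rule closed_compact_sums)
  have "convex P"
    unfolding P_def nonneg_orthant_eq_convex_cone_hull_Basis by (rule convex_convex_cone_hull)
  then have "convex S"
    unfolding S_def by (intro convex_sums convex_linear_image lin_f lin_g convex_cball)
  have mem_S: "f (\<eta>, \<rho>) + g w \<in> S" if "0 \<le> \<eta>" "0 \<le> \<rho>" "norm w \<le> lam" for \<eta> \<rho> w
    using that unfolding S_def
    by (auto simp: P_iff intro!: bexI[of _ "(\<eta>, \<rho>)"] bexI[of _ w])
  have "(v, r) \<in> S"
  proof (rule ccontr)
    assume "(v, r) \<notin> S"
    with separating_hyperplane_closed_point[OF \<open>convex S\<close> \<open>closed S\<close>]
    obtain u \<tau> \<beta> where vr: "u \<bullet> v + \<tau> * r < \<beta>"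
      and sep: "\<And>y. y \<in> S \<Longrightarrow> \<beta> < (u, \<tau>) \<bullet> y"
      by (metis inner_Pair inner_real_def surj_pair)
    have "\<beta> < s * \<tau>" if "0 \<le> s" for s
      using sep[OF mem_S[of 0 s 0]] that lam by (simp add: f_def g_def mult.commute)
    then have "0 \<le> \<tau>" by (rule nonneg_on_ray_if_bounded_below)
    \<comment> \<open>\<open>S\<close> lies on the larger side of the hyperplane, so the sign is
      flipped to get a direction in which \<open>v\<close> is large.\<close>
    define \<xi> where "\<xi> = - u"
    have cone: "C *v \<xi> \<le> \<tau> *\<^sub>R h"
      unfolding less_eq_vec_def
    proof
      fix j
      \<comment> \<open>The multiplier \<open>axis j s\<close> isolates row \<open>j\<close> of the
        system.\<close>
      have "\<beta> < s * ((C *v u) $ j + \<tau> * h $ j)" if "0 \<le> s" for s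
      proof -
        have "u \<bullet> (transpose C *v axis j s) = s * (C *v u) $ j"
          by (metis inner_transpose_mult inner_commute inner_axis inner_real_def mult.commute)
        moreover have "axis j s \<bullet> h = s * h $ j"
          by (metis inner_axis inner_commute inner_real_def mult.commute)
        moreover have "0 \<le> axis j s"
          using that by (simp add: zero_le_vec_iff axis_def)
        ultimately show ?thesis
          using sep[OF mem_S[of "axis j s" 0 0]] lam
          by (simp add: f_def g_def algebra_simps)
      qed
      then have "0 \<le> (C *v u) $ j + \<tau> * h $ j"
        by (rule nonneg_on_ray_if_bounded_below)
      moreover have "C *v \<xi> = - (C *v u)"
        unfolding \<xi>_def by (rule linear_neg) simp
      ultimately show "(C *v \<xi>) $ j \<le> (\<tau> *\<^sub>R h) $ j" by simp
    qed
    have strict: "\<tau> * r < v \<bullet> \<xi> - lam * norm (\<xi> - \<tau> *\<^sub>R \<xi>0)"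
    proof -
      define d where "d = \<xi> - \<tau> *\<^sub>R \<xi>0"
      \<comment> \<open>This point of the ball maximises the inner product with \<open>d\<close>,
        giving equality in Cauchy-Schwarz. Since \<open>sgn 0 = 0\<close>, the case
        \<open>d = 0\<close> is covered.\<close>
      define w where "w = lam *\<^sub>R sgn d"
      have "norm w \<le> lam" using lam by (simp add: w_def norm_sgn)
      then have "\<beta> < u \<bullet> w + \<tau> * (w \<bullet> \<xi>0)"
        using sep[OF mem_S[of 0 0 w]] by (simp add: f_def g_def)
      also have "\<dots> = - (w \<bullet> d)"
        by (simp add: d_def \<xi>_def inner_diff_right inner_commute algebra_simps)
      also have "w \<bullet> d = lam * norm d"
        by (cases "d = 0") (simp_all add: w_def sgn_div_norm dot_square_norm power2_eq_square)
      finally have "\<beta> < - (lam * norm d)" .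
      moreover have "u \<bullet> v = - (v \<bullet> \<xi>)" by (simp add: \<xi>_def inner_commute)
      ultimately show ?thesis
        unfolding d_def[symmetric] using vr by linarith
    qed
    show False
    proof (cases "\<tau> = 0")
      case True
      \<comment> \<open>For \<open>\<tau> = 0\<close>, \<open>cone\<close> makes
        \<open>\<xi>\<close> a recession direction of the polyhedron, and \<open>\<delta>\<close> is
        the growth rate of the penalised objective along it.\<close>
      define \<delta> where "\<delta> = v \<bullet> \<xi> - lam * norm \<xi>"
      have "0 < \<delta>" using strict True by (simp add: \<delta>_def)
      \<comment> \<open>Chosen so that the gain \<open>s * \<delta>\<close> exceeds the gap
        \<open>r - v \<bullet> \<xi>0\<close> by at least 1.\<close>
      define s where "s = (\<bar>r - v \<bullet> \<xi>0\<bar> + 1) / \<delta>"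
      have "0 \<le> s" using \<open>0 < \<delta>\<close> by (simp add: s_def)
      have "C *v (\<xi>0 + s *\<^sub>R \<xi>) \<le> h"
        unfolding less_eq_vec_def
      proof
        fix j
        have "s * (C *v \<xi>) $ j \<le> 0"
          using cone True \<open>0 \<le> s\<close> by (simp add: less_eq_vec_def mult_nonneg_nonpos)
        moreover have "(C *v \<xi>0) $ j \<le> h $ j" using \<xi>0 by (simp add: less_eq_vec_def)
        ultimately show "(C *v (\<xi>0 + s *\<^sub>R \<xi>)) $ j \<le> h $ j"
          by (simp add: matrix_vector_right_distrib matrix_vector_mult_scaleR)
      qed
      from bound[OF this] have "v \<bullet> \<xi>0 + s * \<delta> \<le> r"
        using \<open>0 \<le> s\<close> by (simp add: \<delta>_def inner_add_right algebra_simps)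
      moreover have "s * \<delta> = \<bar>r - v \<bullet> \<xi>0\<bar> + 1" using \<open>0 < \<delta>\<close> by (simp add: s_def)
      ultimately show False by linarith
    next
      case False
      with \<open>0 \<le> \<tau>\<close> have "0 < \<tau>" by simp
      \<comment> \<open>Both \<open>cone\<close> and \<open>strict\<close> are positively
        homogeneous in \<open>(\<xi>, \<tau>)\<close>, so the pair may be rescaled to
        \<open>\<tau> = 1\<close>.\<close>
      define \<zeta> where "\<zeta> = (1 / \<tau>) *\<^sub>R \<xi>"
      have \<xi>: "\<xi> = \<tau> *\<^sub>R \<zeta>" using False by (simp add: \<zeta>_def)
      have "C *v \<zeta> \<le> h"
        using cone \<open>0 < \<tau>\<close> by (simp add: \<xi> matrix_vector_mult_scaleR less_eq_vec_def)
      from bound[OF this]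
      have "\<tau> * (v \<bullet> \<zeta> - lam * norm (\<zeta> - \<xi>0)) \<le> \<tau> * r"
        using \<open>0 < \<tau>\<close> by simp
      also have "\<tau> * (v \<bullet> \<zeta> - lam * norm (\<zeta> - \<xi>0)) = v \<bullet> \<xi> - lam * norm (\<xi> - \<tau> *\<^sub>R \<xi>0)"
      proof -
        have "\<xi> - \<tau> *\<^sub>R \<xi>0 = \<tau> *\<^sub>R (\<zeta> - \<xi>0)" by (simp add: \<xi> scaleR_diff_right)
        then have "norm (\<xi> - \<tau> *\<^sub>R \<xi>0) = \<tau> * norm (\<zeta> - \<xi>0)" using \<open>0 < \<tau>\<close> by simp
        then show ?thesis by (simp add: \<xi> right_diff_distrib)
      qed
      finally show False using strict by simp
    qed
  qed
  then obtain \<eta> \<rho> w where "(\<eta>, \<rho>) \<in> P" "norm w \<le> lam" "(v, r) = f (\<eta>, \<rho>) + g w"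
    unfolding S_def by auto
  then show ?thesis
    by (intro exI[of _ \<eta>]) (auto simp: P_iff f_def g_def)
qed

text \<open>Splitting \<open>v\<close> into residual and \<open>transpose C *v \<eta>\<close>
  separates the two estimates: the penalty absorbs the residual, and the sign of
  \<open>\<eta>\<close> handles the polyhedral part.\<close>

lemma norm_penalised_weak_duality:
  fixes C :: "real ^ 'm ^ 'q"
  assumes "C *v \<xi> \<le> h" "0 \<le> \<eta>" "norm (v - transpose C *v \<eta>) \<le> lam"
  shows "v \<bullet> \<xi> - lam * norm (\<xi> - \<xi>0) \<le> (v - transpose C *v \<eta>) \<bullet> \<xi>0 + \<eta> \<bullet> h"
proof -
  define w where "w = v - transpose C *v \<eta>"
  have "v \<bullet> \<xi> = w \<bullet> (\<xi> - \<xi>0) + w \<bullet> \<xi>0 + \<eta> \<bullet> (C *v \<xi>)"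
    by (simp add: w_def inner_diff_left inner_diff_right dot_lmul_matrix)
  moreover have "w \<bullet> (\<xi> - \<xi>0) \<le> lam * norm (\<xi> - \<xi>0)"
    using assms(3) norm_cauchy_schwarz[of w "\<xi> - \<xi>0"]
    unfolding w_def by (meson mult_right_mono norm_ge_zero order_trans)
  moreover have "\<eta> \<bullet> (C *v \<xi>) \<le> \<eta> \<bullet> h"
    by (rule inner_mono_nonneg_vec) (use assms in auto)
  ultimately show ?thesis by (simp add: w_def)
qed

section \<open>Convexity of the reformulated problem\<close>

text \<open>The matrix terms enter through \<open>L\<close>, which is jointly linear in
  \<open>x\<close> and the multiplier. What remains nonlinear, \<open>b k\<close>, the norm and the
  positive part, is convex and on the smaller side of its inequality.\<close>

lemma convex_dual_feasible:
  fixes C :: "real ^ 'm ^ 'q"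
    and A :: "'k::finite \<Rightarrow> real ^ 'm ^ 'n" and xihat :: "'i::finite \<Rightarrow> real ^ 'm"
  assumes "convex X" and b: "\<And>k. convex_on UNIV (b k)"
  shows "convex (dual_feasible C h A b X xihat \<theta> \<alpha>)"
proof (rule convexI)
  let ?D = "dual_feasible C h A b X xihat \<theta> \<alpha>"
  fix p q and u v :: real
  assume p: "p \<in> ?D" and q: "q \<in> ?D" and uv: "0 \<le> u" "0 \<le> v" "u + v = 1"
  obtain x l t s e where p_eq: "p = (x, l, t, s, e)" by (metis prod_cases5)
  obtain x' l' t' s' e' where q_eq: "q = (x', l', t', s', e')" by (metis prod_cases5)
  define L where "L k x \<eta> = transpose (A k) *v x - transpose C *v \<eta>" for k x \<eta>
  \<comment> \<open>The positive part is split into two inequalities. That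
    \<open>0 \<le> s $ i\<close> becomes free of \<open>k\<close> uses that the index type
    \<open>'k\<close> is nonempty.\<close>
  have D_iff: "(x, l, t, s, e) \<in> ?D \<longleftrightarrow>
      l * \<theta> + 1 / real CARD('i) * (\<Sum>i\<in>UNIV. s $ i) \<le> t * \<alpha>
      \<and> (\<forall>i k. b k x + t + L k x (e $ i $ k) \<bullet> xihat i + (e $ i $ k) \<bullet> h \<le> s $ i)
      \<and> (\<forall>i. 0 \<le> s $ i)
      \<and> (\<forall>i k. norm (L k x (e $ i $ k)) \<le> l) \<and> (\<forall>i k j. 0 \<le> e $ i $ k $ j)
      \<and> x \<in> X \<and> 0 \<le> l" for x l t s e
    unfolding dual_feasible_def L_def by (auto simp: zero_le_vec_iff)
  note pD = p[unfolded p_eq D_iff] and qD = q[unfolded q_eq D_iff]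
  have comb: "u * a + v * a' \<le> u * c + v * c'" if "a \<le> c" "a' \<le> c'" for a a' c c' :: real
    using that uv by (intro add_mono mult_left_mono)
  have L: "L k (u *\<^sub>R x + v *\<^sub>R x') (u *\<^sub>R y + v *\<^sub>R y') = u *\<^sub>R L k x y + v *\<^sub>R L k x' y'"
    for k x x' y y'
    by (simp add: L_def matrix_vector_right_distrib matrix_vector_mult_scaleR
        algebra_simps del: transpose_matrix_vector)
  have "(u *\<^sub>R x + v *\<^sub>R x', u * l + v * l', u * t + v * t', u *\<^sub>R s + v *\<^sub>R s', u *\<^sub>R e + v *\<^sub>R e') \<in> ?D"
    unfolding D_iff
  proof (intro conjI allI)
    have "u * (l * \<theta> + 1 / real CARD('i) * (\<Sum>i\<in>UNIV. s $ i))
        + v * (l' * \<theta> + 1 / real CARD('i) * (\<Sum>i\<in>UNIV. s' $ i)) \<le> u * (t * \<alpha>) + v * (t' * \<alpha>)"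
      using pD qD by (intro comb) auto
    then show "(u * l + v * l') * \<theta>
        + 1 / real CARD('i) * (\<Sum>i\<in>UNIV. (u *\<^sub>R s + v *\<^sub>R s') $ i) \<le> (u * t + v * t') * \<alpha>"
      by (simp add: sum.distrib sum_distrib_left[symmetric] add_divide_distrib algebra_simps)
  next
    fix i k
    have "b k (u *\<^sub>R x + v *\<^sub>R x') \<le> u * b k x + v * b k x'"
      using b[of k] uv by (simp add: convex_on_def)
    moreover have "u * (b k x + t + L k x (e $ i $ k) \<bullet> xihat i + (e $ i $ k) \<bullet> h)
       + v * (b k x' + t' + L k x' (e' $ i $ k) \<bullet> xihat i + (e' $ i $ k) \<bullet> h) \<le> u * s $ i + v * s' $ i"
      using pD qD by (intro comb) auto
    ultimately show "b k (u *\<^sub>R x + v *\<^sub>R x') + (u * t + v * t')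
        + L k (u *\<^sub>R x + v *\<^sub>R x') ((u *\<^sub>R e + v *\<^sub>R e') $ i $ k) \<bullet> xihat i
        + ((u *\<^sub>R e + v *\<^sub>R e') $ i $ k) \<bullet> h \<le> (u *\<^sub>R s + v *\<^sub>R s') $ i"
      by (simp add: L inner_add_left distrib_left)
    have "norm (L k (u *\<^sub>R x + v *\<^sub>R x') ((u *\<^sub>R e + v *\<^sub>R e') $ i $ k))
        \<le> u * norm (L k x (e $ i $ k)) + v * norm (L k x' (e' $ i $ k))"
      using norm_triangle_ineq[of "u *\<^sub>R L k x (e $ i $ k)" "v *\<^sub>R L k x' (e' $ i $ k)"] uv
      by (simp add: L)
    also have "\<dots> \<le> u * l + v * l'"
      using pD qD by (intro comb) auto
    finally show "norm (L k (u *\<^sub>R x + v *\<^sub>R x') ((u *\<^sub>R e + v *\<^sub>R e') $ i $ k)) \<le> u * l + v * l'" .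
  next
    show "u *\<^sub>R x + v *\<^sub>R x' \<in> X"
      using \<open>convex X\<close> pD qD uv by (auto intro: convexD)
  qed (use pD qD uv in auto)
  then show "u *\<^sub>R p + v *\<^sub>R q \<in> ?D"
    by (simp add: p_eq q_eq)
qed

lemma convex_on_dual_objective:
  assumes "convex S"
  shows "convex_on S (dual_objective c)"
  using assms
  by (auto simp: convex_on_def dual_objective_def inner_add_right)

section \<open>Equivalence of the two constraint systems\<close>

text \<open>An upper bound on a supremum of maxima is a bound for each \<open>\<xi>\<close> and each
  \<open>k\<close>. Exchanging these quantifiers leaves one duality problem per piece, hence a
  separate multiplier for each \<open>k\<close>.\<close>

lemma cvar_constraint_iff:
  fixes C :: "real ^ 'm ^ 'q" and A :: "'k::finite \<Rightarrow> real ^ 'm ^ 'n"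
  assumes "C *v \<xi>0 \<le> h" "0 \<le> lam"
    and F: "\<And>\<xi>. F \<xi> = (MAX k. x \<bullet> (A k *v \<xi>) + b k x)"
  shows "(SUP \<xi>\<in>{\<xi>. C *v \<xi> \<le> h}. ereal (F \<xi> + t - lam * norm (\<xi> - \<xi>0))) \<le> ereal s
    \<longleftrightarrow> (\<forall>k. \<exists>\<eta>\<ge>0. norm (transpose (A k) *v x - transpose C *v \<eta>) \<le> lam
          \<and> b k x + t + (transpose (A k) *v x - transpose C *v \<eta>) \<bullet> \<xi>0 + \<eta> \<bullet> h \<le> s)"
    (is "_ \<longleftrightarrow> (\<forall>k. ?dual k)")
proof -
  have F_le: "F \<xi> \<le> y \<longleftrightarrow> (\<forall>k. x \<bullet> (A k *v \<xi>) + b k x \<le> y)" for \<xi> y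
    unfolding F by (subst Max_le_iff) auto
  have "(SUP \<xi>\<in>{\<xi>. C *v \<xi> \<le> h}. ereal (F \<xi> + t - lam * norm (\<xi> - \<xi>0))) \<le> ereal s
      \<longleftrightarrow> (\<forall>\<xi>. C *v \<xi> \<le> h \<longrightarrow> F \<xi> \<le> s - t + lam * norm (\<xi> - \<xi>0))"
    by (auto simp: SUP_le_iff algebra_simps)
  also have "\<dots> \<longleftrightarrow> (\<forall>k \<xi>. C *v \<xi> \<le> h \<longrightarrow>
      (transpose (A k) *v x) \<bullet> \<xi> - lam * norm (\<xi> - \<xi>0) \<le> s - t - b k x)"
    unfolding F_le inner_transpose_mult by (auto simp: algebra_simps)
  also have "\<dots> \<longleftrightarrow> (\<forall>k. ?dual k)"
  proof (rule iff_allI)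
    fix k
    \<comment> \<open>Duality is applied with \<open>r = s - t - b k x\<close>, the part of the
      constraint independent of \<open>\<xi>\<close> and \<open>\<eta>\<close>.\<close>
    have "(\<forall>\<xi>. C *v \<xi> \<le> h \<longrightarrow> (transpose (A k) *v x) \<bullet> \<xi> - lam * norm (\<xi> - \<xi>0) \<le> s - t - b k x)
      \<longleftrightarrow> (\<exists>\<eta>\<ge>0. norm (transpose (A k) *v x - transpose C *v \<eta>) \<le> lam
          \<and> (transpose (A k) *v x - transpose C *v \<eta>) \<bullet> \<xi>0 + \<eta> \<bullet> h \<le> s - t - b k x)"
      using norm_penalised_Farkas[OF assms(2,1)] norm_penalised_weak_duality[of C _ h]
      by (meson order_trans)
    also have "\<dots> \<longleftrightarrow> ?dual k"
      by (simp add: algebra_simps)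
    finally show "(\<forall>\<xi>. C *v \<xi> \<le> h \<longrightarrow>
      (transpose (A k) *v x) \<bullet> \<xi> - lam * norm (\<xi> - \<xi>0) \<le> s - t - b k x) \<longleftrightarrow> ?dual k" .
  qed
  finally show ?thesis .
qed

theorem propositionV1:
  fixes C :: "real ^ 'm ^ 'q" and h :: "real ^ 'q"
    and \<Xi> :: "(real ^ 'm) set"
    and X :: "(real ^ 'n) set" and c :: "real ^ 'n"
    and \<alpha> \<theta> :: real
    and xihat :: "'i::finite \<Rightarrow> real ^ 'm"
    and A :: "'k::finite \<Rightarrow> real ^ 'm ^ 'n" and b :: "'k \<Rightarrow> real ^ 'n \<Rightarrow> real"
    and F :: "real ^ 'n \<Rightarrow> real ^ 'm \<Rightarrow> real"
  assumes "\<Xi> = {\<xi>. C *v \<xi> \<le> h}" and "compact \<Xi>"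
    and "closed X" and "convex X"
    and "0 < \<alpha>" and "\<alpha> < 1" and "\<theta> > 0"
    and "\<And>i. xihat i \<in> \<Xi>"
    and "\<And>x \<xi>. F x \<xi> = (MAX k. x \<bullet> (A k *v \<xi>) + b k x)"
    and "\<And>k. convex_on UNIV (b k)"
  shows "convex (dual_feasible C h A b X xihat \<theta> \<alpha>)
       \<and> convex_on (dual_feasible C h A b X xihat \<theta> \<alpha>) (dual_objective c)
       \<and> (\<forall>x lam t s. (x, lam, t, s) \<in> cvar_feasible F \<Xi> X xihat \<theta> \<alpha>
           \<longleftrightarrow> (\<exists>\<eta>. (x, lam, t, s, \<eta>) \<in> dual_feasible C h A b X xihat \<theta> \<alpha>))
       \<and> (\<forall>x lam t (s :: real ^ 'i) (\<eta> :: real ^ 'q ^ 'k ^ 'i).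
           cvar_objective c (x, lam, t, s) = dual_objective c (x, lam, t, s, \<eta>))"
proof (intro conjI allI)
  show cvx: "convex (dual_feasible C h A b X xihat \<theta> \<alpha>)"
    using assms by (intro convex_dual_feasible)
  show "convex_on (dual_feasible C h A b X xihat \<theta> \<alpha>) (dual_objective c)"
    by (rule convex_on_dual_objective[OF cvx])
next
  fix x :: "real ^ 'n" and lam t and s :: "real ^ 'i"
  define Q where "Q i k \<eta> \<longleftrightarrow> 0 \<le> \<eta> \<and> norm (transpose (A k) *v x - transpose C *v \<eta>) \<le> lam
      \<and> b k x + t + (transpose (A k) *v x - transpose C *v \<eta>) \<bullet> xihat i + \<eta> \<bullet> h \<le> s $ i" for i k \<eta>
  \<comment> \<open>The premise \<open>0 \<le> lam\<close> is available on both sides, as each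
    feasible set imposes it.\<close>
  have sup: "(SUP \<xi>\<in>\<Xi>. ereal (F x \<xi> + t - lam * norm (\<xi> - xihat i))) \<le> ereal (s $ i)
      \<longleftrightarrow> (\<forall>k. \<exists>\<eta>. Q i k \<eta>)" if "0 \<le> lam" for i
    unfolding Q_def assms(1)
    by (rule cvar_constraint_iff) (use that assms(1,8,9) in auto)
  \<comment> \<open>Multipliers found separately for each sample and piece are assembled into one
    array.\<close>
  have choice: "(\<forall>i k. \<exists>\<eta>. Q i k \<eta>) \<longleftrightarrow> (\<exists>\<eta> :: real ^ 'q ^ 'k ^ 'i. \<forall>i k. Q i k (\<eta> $ i $ k))"
  proof
    assume "\<forall>i k. \<exists>\<eta>. Q i k \<eta>"
    then obtain e where "\<And>i k. Q i k (e i k)" by metis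
    then show "\<exists>\<eta> :: real ^ 'q ^ 'k ^ 'i. \<forall>i k. Q i k (\<eta> $ i $ k)"
      by (intro exI[of _ "\<chi> i k. e i k"]) simp
  qed blast
  \<comment> \<open>The explicit condition \<open>0 \<le> s $ i\<close> of the first problem is
    hidden in the positive part of the second.\<close>
  have dual_iff: "(x, lam, t, s, \<eta>) \<in> dual_feasible C h A b X xihat \<theta> \<alpha> \<longleftrightarrow>
      lam * \<theta> + 1 / real CARD('i) * (\<Sum>i\<in>UNIV. s $ i) \<le> t * \<alpha>
      \<and> (\<forall>i k. Q i k (\<eta> $ i $ k)) \<and> 0 \<le> lam \<and> x \<in> X \<and> (\<forall>i. 0 \<le> s $ i)" for \<eta>
    unfolding dual_feasible_def Q_def by auto
  have "(x, lam, t, s) \<in> cvar_feasible F \<Xi> X xihat \<theta> \<alpha> \<longleftrightarrow>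
      lam * \<theta> + 1 / real CARD('i) * (\<Sum>i\<in>UNIV. s $ i) \<le> t * \<alpha>
      \<and> (\<forall>i k. \<exists>\<eta>. Q i k \<eta>) \<and> 0 \<le> lam \<and> x \<in> X \<and> (\<forall>i. 0 \<le> s $ i)"
    unfolding cvar_feasible_def using sup by auto
  also have "\<dots> \<longleftrightarrow> (\<exists>\<eta>. (x, lam, t, s, \<eta>) \<in> dual_feasible C h A b X xihat \<theta> \<alpha>)"
    unfolding choice dual_iff by blast
  finally show "(x, lam, t, s) \<in> cvar_feasible F \<Xi> X xihat \<theta> \<alpha> \<longleftrightarrow>
      (\<exists>\<eta>. (x, lam, t, s, \<eta>) \<in> dual_feasible C h A b X xihat \<theta> \<alpha>)" .
next
  fix x lam t and s :: "real ^ 'i" and \<eta> :: "real ^ 'q ^ 'k ^ 'i"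
  show "cvar_objective c (x, lam, t, s) = dual_objective c (x, lam, t, s, \<eta>)"
    by (simp add: cvar_objective_def dual_objective_def)
qed

end
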